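(* For every SAP instance, the algorithm GREEDY run with the empty initial seminar selection $S_0$ (i.e. $S_0(b)=0$ for all $b\in B$) outputs a feasible seminar assignment whose profit is at least $\frac{1}{2}(1-e^{-1})$ times the maximum profit of a feasible seminar assignment.
   Context: SAP instance: finite set $B$ of seminars, finite set $I$ of students, for each $b\in B$ a set $K_b\subseteq\mathbb{N}$ of allowable numbers of students with $0\in K_b$, profits $p(i,b)\ge 0$. A seminar assignment is $\mathcal{A}:J\to B$ with $J\subseteq I$, feasible if $|\mathcal{A}^{-1}(b)|\in K_b$ for all $b$, with profit $p(\mathcal{A})=\sum_{i\in J}p(i,\mathcal{A}(i))$. A seminar selection is $S:B\to\mathbb{N}$ with $S(b)\in K_b$ for all $b$; it is feasible if $\sum_b S(b)\le |I|$. $p(S)$ is the maximum profit of an assignment assigning exactly $S(b)$ students to each $b$, and $\mathcal{A}_S$ denotes such an optimal assignment. The cost is $c(S)=\sum_b S(b)$. Write $T\succ S$ if $T(b)\ge S(b)$ for all $b$ and $T(b)>S(b)$ for some $b$; $inc(S)$ is the set of feasible selections $T\succ S$ with $T(b)>S(b)$ for exactly one $b$. Algorithm GREEDY with feasible initial selection $S_0$: set $i=0$; while $inc(S_i)\neq\emptyset$, let $S_{i+1}$ be an element of $inc(S_i)$ maximizing $\frac{p(S')-p(S_i)}{c(S')-c(S_i)}$ over $S'\in inc(S_i)$ and increase $i$ by one. Let $\mathcal{A}_1=\mathcal{A}_{S_i}$ for the final $i$. Let $\mathcal{A}_2$ be a feasible assignment of maximum profit among feasible assignments that assign students to only a single seminar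 $b$, where $b$ ranges over seminars with $S_0(b)=0$. Output whichever of $\mathcal{A}_1,\mathcal{A}_2$ has larger profit. *)

theory Defs
  imports Complex_Main
begin

record ('i, 'b) sap =
  students :: "'i set"
  seminars :: "'b set"
  allowable :: "'b \<Rightarrow> nat set"
  student_profit :: "'i \<Rightarrow> 'b \<Rightarrow> real"

definition sap_instance :: "('i, 'b) sap \<Rightarrow> bool" where
  "sap_instance X \<longleftrightarrow>
     finite (students X) \<and> finite (seminars X) \<and>
     (\<forall>b\<in>seminars X. 0 \<in> allowable X b) \<and>
     (\<forall>i\<in>students X. \<forall>b\<in>seminars X. student_profit X i b \<ge> 0)"

text \<open>An assignment of a subset J of the students is a partial map with domain J.\<close>

definition assignment :: "('i, 'b) sap \<Rightarrow> ('i \<rightharpoonup> 'b) \<Rightarrow> bool" where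
  "assignment X A \<longleftrightarrow> dom A \<subseteq> students X \<and> ran A \<subseteq> seminars X"

definition attendance :: "('i \<rightharpoonup> 'b) \<Rightarrow> 'b \<Rightarrow> nat" where
  "attendance A b = card {i. A i = Some b}"

definition feasible_assignment :: "('i, 'b) sap \<Rightarrow> ('i \<rightharpoonup> 'b) \<Rightarrow> bool" where
  "feasible_assignment X A \<longleftrightarrow>
     assignment X A \<and> (\<forall>b\<in>seminars X. attendance A b \<in> allowable X b)"

definition profit :: "('i, 'b) sap \<Rightarrow> ('i \<rightharpoonup> 'b) \<Rightarrow> real" where
  "profit X A = (\<Sum>i\<in>dom A. student_profit X i (the (A i)))"

definition max_profit :: "('i, 'b) sap \<Rightarrow> real" where
  "max_profit X = Max {profit X A |A. feasible_assignment X A}"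

text \<open>Selections are functions on the seminars, encoded as total functions that vanish elsewhere.\<close>

definition selection :: "('i, 'b) sap \<Rightarrow> ('b \<Rightarrow> nat) \<Rightarrow> bool" where
  "selection X S \<longleftrightarrow>
     (\<forall>b\<in>seminars X. S b \<in> allowable X b) \<and> (\<forall>b. b \<notin> seminars X \<longrightarrow> S b = 0)"

definition cost :: "('i, 'b) sap \<Rightarrow> ('b \<Rightarrow> nat) \<Rightarrow> nat" where
  "cost X S = (\<Sum>b\<in>seminars X. S b)"

definition feasible_selection :: "('i, 'b) sap \<Rightarrow> ('b \<Rightarrow> nat) \<Rightarrow> bool" where
  "feasible_selection X S \<longleftrightarrow> selection X S \<and> cost X S \<le> card (students X)"

definition realizes :: "('i, 'b) sap \<Rightarrow> ('b \<Rightarrow> nat) \<Rightarrow> ('i \<rightharpoonup> 'b) \<Rightarrow> bool" where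
  "realizes X S A \<longleftrightarrow> assignment X A \<and> (\<forall>b\<in>seminars X. attendance A b = S b)"

text \<open>Meaningful for feasible selections only: otherwise the maximum is over the empty set.\<close>

definition selection_profit :: "('i, 'b) sap \<Rightarrow> ('b \<Rightarrow> nat) \<Rightarrow> real" where
  "selection_profit X S = Max {profit X A |A. realizes X S A}"

definition optimal_for :: "('i, 'b) sap \<Rightarrow> ('b \<Rightarrow> nat) \<Rightarrow> ('i \<rightharpoonup> 'b) \<Rightarrow> bool" where
  "optimal_for X S A \<longleftrightarrow> realizes X S A \<and> profit X A = selection_profit X S"

definition dominates :: "('i, 'b) sap \<Rightarrow> ('b \<Rightarrow> nat) \<Rightarrow> ('b \<Rightarrow> nat) \<Rightarrow> bool" where
  "dominates X T S \<longleftrightarrow>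
     (\<forall>b\<in>seminars X. T b \<ge> S b) \<and> (\<exists>b\<in>seminars X. T b > S b)"

definition inc :: "('i, 'b) sap \<Rightarrow> ('b \<Rightarrow> nat) \<Rightarrow> ('b \<Rightarrow> nat) set" where
  "inc X S = {T. feasible_selection X T \<and> dominates X T S \<and>
                 (\<exists>!b. b \<in> seminars X \<and> T b > S b)}"

definition incremental_ratio :: "('i, 'b) sap \<Rightarrow> ('b \<Rightarrow> nat) \<Rightarrow> ('b \<Rightarrow> nat) \<Rightarrow> real" where
  "incremental_ratio X S T =
     (selection_profit X T - selection_profit X S) / (real (cost X T) - real (cost X S))"

text \<open>GREEDY is nondeterministic: ties between maximizers, between optimal assignments, and
  between the two final candidates may be broken arbitrarily.  It is therefore modelled by a
  step relation and a relation between the initial selection and the possible outputs.\<close>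

definition greedy_step :: "('i, 'b) sap \<Rightarrow> ('b \<Rightarrow> nat) \<Rightarrow> ('b \<Rightarrow> nat) \<Rightarrow> bool" where
  "greedy_step X S T \<longleftrightarrow>
     T \<in> inc X S \<and> (\<forall>T'\<in>inc X S. incremental_ratio X S T' \<le> incremental_ratio X S T)"

definition greedy_final :: "('i, 'b) sap \<Rightarrow> ('b \<Rightarrow> nat) \<Rightarrow> ('b \<Rightarrow> nat) \<Rightarrow> bool" where
  "greedy_final X S0 S \<longleftrightarrow> (greedy_step X)\<^sup>*\<^sup>* S0 S \<and> inc X S = {}"

text \<open>The bound on the cardinality is not an equality, so that the empty assignment always counts;
  without it there might be no candidate (for example if every seminar only allows 0 students).\<close>

definition single_seminar_assignment ::
    "('i, 'b) sap \<Rightarrow> ('b \<Rightarrow> nat) \<Rightarrow> ('i \<rightharpoonup> 'b) \<Rightarrow> bool" where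
  "single_seminar_assignment X S0 A \<longleftrightarrow>
     feasible_assignment X A \<and> ran A \<subseteq> {b \<in> seminars X. S0 b = 0} \<and> card (ran A) \<le> 1"

definition best_single_seminar_assignment ::
    "('i, 'b) sap \<Rightarrow> ('b \<Rightarrow> nat) \<Rightarrow> ('i \<rightharpoonup> 'b) \<Rightarrow> bool" where
  "best_single_seminar_assignment X S0 A \<longleftrightarrow>
     single_seminar_assignment X S0 A \<and>
     (\<forall>A'. single_seminar_assignment X S0 A' \<longrightarrow> profit X A' \<le> profit X A)"

definition greedy_output :: "('i, 'b) sap \<Rightarrow> ('b \<Rightarrow> nat) \<Rightarrow> ('i \<rightharpoonup> 'b) \<Rightarrow> bool" where
  "greedy_output X S0 A \<longleftrightarrow>
     (\<exists>S A1 A2. greedy_final X S0 S \<and> optimal_for X S A1 \<and>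
        best_single_seminar_assignment X S0 A2 \<and>
        (A = A1 \<and> profit X A1 \<ge> profit X A2 \<or> A = A2 \<and> profit X A2 \<ge> profit X A1))"

text \<open>There is no infinite run, and no reachable selection blocks the loop.\<close>

definition greedy_terminates :: "('i, 'b) sap \<Rightarrow> ('b \<Rightarrow> nat) \<Rightarrow> bool" where
  "greedy_terminates X S0 \<longleftrightarrow>
     \<not> (\<exists>f :: nat \<Rightarrow> 'b \<Rightarrow> nat. f 0 = S0 \<and> (\<forall>n. greedy_step X (f n) (f (Suc n)))) \<and>
     (\<forall>S. (greedy_step X)\<^sup>*\<^sup>* S0 S \<and> inc X S \<noteq> {} \<longrightarrow> (\<exists>T. greedy_step X S T))"

definition empty_selection :: "'b \<Rightarrow> nat" where
  "empty_selection = (\<lambda>b. 0)"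

end

(* Read the quotas of a selection as upper bounds. Since profits are nonnegative, this does not
  change the profit of a feasible selection, and it extends the profit p to arbitrary selections.
  The extended p is submodular: raising the quotas of S one seminar at a time to those of an optimal
  selection T gains in total at least p(T) - p(S). As c(T) is at most the number n of students,
  at every S some raise of S(b) to T(b) has ratio at least (OPT - p(S)) / n. While these raises are
  feasible, every greedy step of cost d shrinks OPT - p(S) by the factor 1 - d/n <= exp(-d/n).
  The first time that such a raise is infeasible, performing it anyway brings the total cost above n,
  so it reaches profit (1 - 1/e) OPT; this profit is at most p(S) plus the profit of seminar b
  alone, hence at most p(A1) + p(A2). *)

theory Submission
  imports Defs
begin

section \<open>Exchange arguments on a finite family of arcs\<close>

text \<open>Each index i is an arc from A i to B i: a student who changes seminar (None stands for
  unassigned).  Then net_arcs is the change in attendance at v if all arcs of D are carried out.\<close>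

definition net_arcs :: "('i \<Rightarrow> 'c) \<Rightarrow> ('i \<Rightarrow> 'c) \<Rightarrow> 'i set \<Rightarrow> 'c \<Rightarrow> int" where
  "net_arcs A B D v = (\<Sum>i\<in>D. of_bool (B i = v) - of_bool (A i = v))"

lemma net_arcs_insert:
  "finite D \<Longrightarrow> i \<notin> D \<Longrightarrow>
    net_arcs A B (insert i D) v = of_bool (B i = v) - of_bool (A i = v) + net_arcs A B D v"
  by (simp add: net_arcs_def)

lemma net_arcs_cong:
  "(\<And>i. i \<in> D \<Longrightarrow> A i = A' i \<and> B i = B' i) \<Longrightarrow> net_arcs A B D v = net_arcs A' B' D v"
  unfolding net_arcs_def by (intro sum.cong) auto

text \<open>This replaces the decomposition of the arcs into cycles and paths: the colour of an arc is
  the end of the path through it, so that carrying out one colour overfills that end only.  The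
  induction contracts two consecutive arcs to one.\<close>

lemma exchange_colouring:
  fixes A B :: "'i \<Rightarrow> 'c"
  assumes "finite D"
  shows "\<exists>g. (\<forall>i\<in>D. g i \<in> B ` D) \<and>
    (\<forall>c v. net_arcs A B {i\<in>D. g i = c} v \<le> (if v = c then max 0 (net_arcs A B D v) else 0))"
  using assms
proof (induction "card D" arbitrary: D B rule: less_induct)
  case less
  show ?case
  proof (cases "\<exists>i\<in>D. A i = B i")
    case True
    then obtain i where i: "i \<in> D" "A i = B i" by blast
    define E where "E = D - {i}"
    have D: "D = insert i E" "i \<notin> E" "finite E" using i less.prems by (auto simp: E_def)
    have "card E < card D" using D by simp
    from less.hyps[OF this D(3), of B] obtain g where
      g: "\<forall>j\<in>E. g j \<in> B ` E"
        "\<And>c v. net_arcs A B {j\<in>E. g j = c} v \<le> (if v = c then max 0 (net_arcs A B E v) else 0)"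
      by blast
    let ?h = "g(i := B i)"
    have eq: "net_arcs A B {j\<in>D. ?h j = c} v = net_arcs A B {j\<in>E. g j = c} v" for c v
    proof (cases "c = B i")
      case True
      have "{j\<in>D. ?h j = c} = insert i {j\<in>E. g j = c}" using D True by auto
      then show ?thesis using D i by (simp add: net_arcs_insert)
    next
      case False
      have "{j\<in>D. ?h j = c} = {j\<in>E. g j = c}" using D False by auto
      then show ?thesis by simp
    qed
    have net: "net_arcs A B D v = net_arcs A B E v" for v
      using D i by (simp add: net_arcs_insert)
    have "\<forall>j\<in>D. ?h j \<in> B ` D" using g(1) D by auto
    moreover have "net_arcs A B {j\<in>D. ?h j = c} v \<le> (if v = c then max 0 (net_arcs A B D v) else 0)"
      for c v using g(2)[of c v] by (simp only: eq net)
    ultimately show ?thesis by blast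
  next
    case no_loop: False
    show ?thesis
    proof (cases "\<exists>i\<in>D. \<exists>j\<in>D. B i = A j")
      case True
      then obtain i j where ij: "i \<in> D" "j \<in> D" "B i = A j" by blast
      with no_loop have "i \<noteq> j" by metis
      define E where "E = D - {j}"
      define F where "F = E - {i}"
      have D: "D = insert j E" "j \<notin> E" "finite E" "i \<in> E"
        using ij \<open>i \<noteq> j\<close> less.prems by (auto simp: E_def)
      have E: "E = insert i F" "i \<notin> F" "finite F" "j \<notin> F"
        using D by (auto simp: F_def)
      \<comment> \<open>The arc \<open>i\<close> ends where \<open>j\<close> starts. The contracted
        arc from \<open>A i\<close> to \<open>B j\<close> keeps the index \<open>i\<close>, and
        \<open>j\<close> is dropped.\<close>
      define B' where "B' = B(i := B j)"
      have "card E < card D" using D by simp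
      from less.hyps[OF this D(3), of B'] obtain g where
        g: "\<forall>k\<in>E. g k \<in> B' ` E"
          "\<And>c v. net_arcs A B' {k\<in>E. g k = c} v \<le> (if v = c then max 0 (net_arcs A B' E v) else 0)"
        by blast
      \<comment> \<open>Since \<open>j\<close> inherits the colour of \<open>i\<close>, both halves
        of the contracted arc lie in the same class and their contributions at the common vertex
        cancel.\<close>
      let ?h = "g(j := g i)"
      have merge: "net_arcs A B (insert j (insert i G)) v = net_arcs A B' (insert i G) v"
        if "G \<subseteq> F" for G v
      proof -
        have G: "finite G" "i \<notin> G" "j \<notin> G" using that E finite_subset by auto
        have "net_arcs A B' G v = net_arcs A B G v"
          using G by (intro net_arcs_cong) (auto simp: B'_def)
        then show ?thesis
          using G \<open>i \<noteq> j\<close> ij by (simp add: net_arcs_insert B'_def)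
      qed
      have eq: "net_arcs A B {k\<in>D. ?h k = c} v = net_arcs A B' {k\<in>E. g k = c} v" for c v
      proof (cases "c = g i")
        case True
        have "{k\<in>D. ?h k = c} = insert j (insert i {k\<in>F. g k = c})"
          "{k\<in>E. g k = c} = insert i {k\<in>F. g k = c}"
          using D E True by auto
        then show ?thesis using merge[of "{k\<in>F. g k = c}"] by simp
      next
        case False
        have "{k\<in>D. ?h k = c} = {k\<in>E. g k = c}" using D False by auto
        then show ?thesis using False by (auto intro: net_arcs_cong simp: B'_def)
      qed
      have net: "net_arcs A B D v = net_arcs A B' E v" for v
        using merge[of F v] D E by simp
      have "B' ` E \<subseteq> B ` D" using D by (auto simp: B'_def)
      then have "\<forall>k\<in>D. ?h k \<in> B ` D" using g(1) D(1,4) by (metis fun_upd_apply insert_iff subsetD)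
      moreover have "net_arcs A B {k\<in>D. ?h k = c} v
          \<le> (if v = c then max 0 (net_arcs A B D v) else 0)" for c v
        using g(2)[of c v] by (simp only: eq net)
      ultimately show ?thesis by blast
    next
      case False
      \<comment> \<open>No arc starts where an arc ends, so every path is a single arc and its
        colour is its own end. A vertex that some arc enters has no outgoing arc, hence its class
        already accounts for its whole net change.\<close>
      have "net_arcs A B {i\<in>D. B i = c} v \<le> (if v = c then max 0 (net_arcs A B D v) else 0)" for c v
      proof (cases "v = c")
        case True
        show ?thesis
        proof (cases "\<exists>i\<in>D. B i = v")
          case True
          then have "\<And>i. i \<in> D \<Longrightarrow> A i \<noteq> v" using False by metis
          then have "net_arcs A B {i\<in>D. B i = c} v = net_arcs A B D v"
            unfolding net_arcs_def using less.prems \<open>v = c\<close>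
            by (intro sum.mono_neutral_left) auto
          then show ?thesis using \<open>v = c\<close> by simp
        next
          case False
          then have "{i\<in>D. B i = c} = {}" using \<open>v = c\<close> by auto
          then show ?thesis by (simp only: net_arcs_def sum.empty) simp
        qed
      next
        case False
        then have "net_arcs A B {i\<in>D. B i = c} v \<le> 0"
          unfolding net_arcs_def by (intro sum_nonpos) auto
        then show ?thesis using False by simp
      qed
      then have "(\<forall>i\<in>D. B i \<in> B ` D) \<and>
        (\<forall>c v. net_arcs A B {i\<in>D. B i = c} v \<le> (if v = c then max 0 (net_arcs A B D v) else 0))"
        by blast
      then show ?thesis by blast
    qed
  qed
qed

section \<open>Decay of the distance to the optimum\<close>

text \<open>Here \<open>q\<close> is the optimum, \<open>p\<close> and \<open>p'\<close> are the
  profits before and after a raise of cost \<open>d\<close>, and \<open>k\<close> is the cost spent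
  before. The raise closes at least the fraction \<open>d / n\<close> of the gap, and
  \<open>1 - d / n\<close> is at most \<open>exp (- d / n)\<close>.\<close>

lemma gap_contraction:
  fixes n d k q p p' :: real
  assumes "0 < n" "d * (q - p) \<le> n * (p' - p)" "p \<le> q" "q - p \<le> exp (- k / n) * q"
  shows "q - p' \<le> exp (- (k + d) / n) * q"
proof -
  have "q - p' \<le> (1 - d / n) * (q - p)" using assms by (simp add: field_simps)
  also have "\<dots> \<le> exp (- (d / n)) * (q - p)"
    using exp_ge_add_one_self[of "- (d / n)"] assms by (intro mult_right_mono) auto
  also have "\<dots> \<le> exp (- (d / n)) * (exp (- k / n) * q)"
    using assms by (intro mult_left_mono) auto
  also have "\<dots> = exp (- (k + d) / n) * q"
    using assms(1) by (simp add: exp_add[symmetric] field_simps)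
  finally show ?thesis .
qed

section \<open>Quotas as upper bounds\<close>

definition within_capacity :: "('i, 'b) sap \<Rightarrow> ('b \<Rightarrow> nat) \<Rightarrow> ('i \<rightharpoonup> 'b) \<Rightarrow> bool" where
  "within_capacity X S A \<longleftrightarrow> assignment X A \<and> (\<forall>b\<in>seminars X. attendance A b \<le> S b)"

text \<open>The empty assignment always competes, so this maximum is meaningful for every
  \<open>S\<close>, including quotas that are not allowable or exceed the number of students in
  total.\<close>

definition capacity_profit :: "('i, 'b) sap \<Rightarrow> ('b \<Rightarrow> nat) \<Rightarrow> real" where
  "capacity_profit X S = Max {profit X A |A. within_capacity X S A}"

text \<open>With profit 0 for unassigned students, the profit of every assignment becomes a sum over
  the same set \<open>students X\<close>, and two assignments can be compared student by
  student.\<close>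

definition option_profit :: "('i, 'b) sap \<Rightarrow> 'i \<Rightarrow> 'b option \<Rightarrow> real" where
  "option_profit X i v = (case v of None \<Rightarrow> 0 | Some b \<Rightarrow> student_profit X i b)"

context
  fixes X :: "('i, 'b) sap"
  assumes inst: "sap_instance X"
begin

section \<open>Finiteness, attendance and profit of assignments\<close>

lemma finite_students: "finite (students X)" and finite_seminars: "finite (seminars X)"
  and zero_allowable: "b \<in> seminars X \<Longrightarrow> 0 \<in> allowable X b"
  and student_profit_nonneg: "i \<in> students X \<Longrightarrow> b \<in> seminars X \<Longrightarrow> 0 \<le> student_profit X i b"
  using inst by (auto simp: sap_instance_def)

lemma finite_assignments: "finite {A. assignment X A}"
proof -
  have "{A. assignment X A} \<subseteq> (\<Union>J\<in>Pow (students X). {A. dom A = J \<and> ran A \<subseteq> seminars X})"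
    by (auto simp: assignment_def)
  moreover have "finite \<dots>"
    using finite_students finite_seminars
    by (auto intro!: finite_set_of_finite_maps intro: finite_subset)
  ultimately show ?thesis by (rule finite_subset)
qed

lemma finite_profits:
  assumes "\<And>A. P A \<Longrightarrow> assignment X A"
  shows "finite {profit X A |A. P A}"
proof -
  have "{profit X A |A. P A} \<subseteq> profit X ` {A. assignment X A}" using assms by auto
  then show ?thesis using finite_assignments finite_surj by blast
qed

lemma ex_max_profit:
  assumes "\<And>A. P A \<Longrightarrow> assignment X A" "P A0"
  shows "\<exists>A. P A \<and> profit X A = Max {profit X A |A. P A}"
proof -
  have "Max {profit X A |A. P A} \<in> {profit X A |A. P A}"
    using assms finite_profits by (intro Max_in) auto
  then show ?thesis by force
qed

lemma profit_le_Max: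
  assumes "\<And>A. P A \<Longrightarrow> assignment X A" "P A0"
  shows "profit X A0 \<le> Max {profit X A |A. P A}"
  using assms finite_profits by (intro Max_ge) auto

lemma assignment_SomeD:
  assumes "assignment X A" "A i = Some b"
  shows "i \<in> students X" "b \<in> seminars X"
  using assms by (auto simp: assignment_def dom_def ran_def)

lemma assignment_empty: "assignment X Map.empty"
  by (simp add: assignment_def)

lemma finite_attendees: "assignment X A \<Longrightarrow> finite {i. A i = Some b}"
  by (rule finite_subset[OF _ finite_students]) (auto dest: assignment_SomeD)

lemma attendance_eq_0_iff: "assignment X A \<Longrightarrow> attendance A b = 0 \<longleftrightarrow> (\<forall>i. A i \<noteq> Some b)"
  using finite_attendees by (auto simp: attendance_def)

lemma attendance_outside: "assignment X A \<Longrightarrow> b \<notin> seminars X \<Longrightarrow> attendance A b = 0"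
  using attendance_eq_0_iff assignment_SomeD by metis

lemma profit_eq_sum:
  assumes "assignment X A"
  shows "profit X A = (\<Sum>i\<in>students X. option_profit X i (A i))"
proof -
  have "profit X A = (\<Sum>i\<in>dom A. option_profit X i (A i))"
    unfolding profit_def by (intro sum.cong) (auto simp: option_profit_def)
  also have "\<dots> = (\<Sum>i\<in>students X. option_profit X i (A i))"
    using assms finite_students
    by (intro sum.mono_neutral_left) (auto simp: assignment_def option_profit_def split: option.splits)
  finally show ?thesis .
qed

lemma option_profit_nonneg:
  "assignment X A \<Longrightarrow> 0 \<le> option_profit X i (A i)"
  by (auto simp: option_profit_def split: option.splits
      intro: student_profit_nonneg dest: assignment_SomeD)

lemma profit_nonneg: "assignment X A \<Longrightarrow> 0 \<le> profit X A"
  by (simp add: profit_eq_sum option_profit_nonneg sum_nonneg)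

lemma sum_attendance:
  assumes "assignment X A"
  shows "(\<Sum>b\<in>seminars X. attendance A b) = card (dom A)"
proof -
  have "dom A = (\<Union>b\<in>seminars X. {i. A i = Some b})"
    using assignment_SomeD[OF assms] by auto
  moreover have "card \<dots> = (\<Sum>b\<in>seminars X. card {i. A i = Some b})"
    using finite_seminars finite_attendees[OF assms] by (intro card_UN_disjoint) auto
  ultimately show ?thesis by (simp add: attendance_def)
qed

lemma attendance_int:
  assumes "assignment X A"
  shows "int (attendance A b) = (\<Sum>i\<in>students X. of_bool (A i = Some b))"
proof -
  have "{i. A i = Some b} = students X \<inter> {i. A i = Some b}"
    using assignment_SomeD[OF assms] by auto
  then show ?thesis using finite_students by (simp add: attendance_def sum_of_bool_eq)
qed

section \<open>Profit under upper bounds and under exact quotas\<close>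

lemma within_capacity_assignment: "within_capacity X S A \<Longrightarrow> assignment X A"
  by (simp add: within_capacity_def)

lemma within_capacity_empty: "within_capacity X S Map.empty"
  by (simp add: within_capacity_def assignment_empty attendance_def)

lemma capacity_profit_attained:
  obtains A where "within_capacity X S A" "profit X A = capacity_profit X S"
proof -
  have "\<exists>A. within_capacity X S A \<and> profit X A = capacity_profit X S"
    unfolding capacity_profit_def
    by (rule ex_max_profit[of "within_capacity X S", OF within_capacity_assignment within_capacity_empty])
  then show ?thesis using that by blast
qed

lemma profit_le_capacity_profit: "within_capacity X S A \<Longrightarrow> profit X A \<le> capacity_profit X S"
  unfolding capacity_profit_def
  by (rule profit_le_Max[of "within_capacity X S", OF within_capacity_assignment])

lemma capacity_profit_mono:
  assumes "\<And>b. b \<in> seminars X \<Longrightarrow> S b \<le> T b"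
  shows "capacity_profit X S \<le> capacity_profit X T"
proof -
  obtain A where A: "within_capacity X S A" "profit X A = capacity_profit X S"
    by (rule capacity_profit_attained)
  have "within_capacity X T A" using A(1) assms by (fastforce simp: within_capacity_def)
  from profit_le_capacity_profit[OF this] A(2) show ?thesis by simp
qed

lemma capacity_profit_nonneg: "0 \<le> capacity_profit X S"
  using profit_le_capacity_profit[OF within_capacity_empty] by (simp add: profit_def)

text \<open>While some seminar is below its quota, fewer than \<open>cost X S\<close> students are
  assigned, so a student is still free. Placing this student there loses nothing, because profits
  are nonnegative; the number of open places decreases.\<close>

lemma extend_to_realization:
  assumes "cost X S \<le> card (students X)" "within_capacity X S A"
  shows "\<exists>A'. realizes X S A' \<and> profit X A \<le> profit X A'"
  using assms(2)
proof (induction "cost X S - card (dom A)" arbitrary: A rule: less_induct)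
  case less
  note A = within_capacity_assignment[OF less.prems]
  show ?case
  proof (cases "\<forall>b\<in>seminars X. attendance A b = S b")
    case True
    then show ?thesis using A by (auto simp: realizes_def)
  next
    case False
    then obtain b where b: "b \<in> seminars X" "attendance A b < S b"
      using less.prems by (force simp: within_capacity_def)
    have "(\<Sum>b\<in>seminars X. attendance A b) < cost X S"
      unfolding cost_def using b less.prems finite_seminars
      by (intro sum_strict_mono_ex1) (auto simp: within_capacity_def)
    then have lt: "card (dom A) < cost X S" using sum_attendance[OF A] by simp
    then have "card (dom A) < card (students X)" using assms(1) by simp
    then have "\<not> students X \<subseteq> dom A"
      using card_mono[of "dom A" "students X"] A finite_students
      by (metis assignment_def leD rev_finite_subset)
    then obtain i where i: "i \<in> students X" "A i = None" by blast
    define A' where "A' = A(i \<mapsto> b)"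
    have A': "assignment X A'" unfolding assignment_def
    proof
      show "dom A' \<subseteq> students X" using A i by (auto simp: A'_def assignment_def)
      show "ran A' \<subseteq> seminars X"
        using A i b by (auto simp: A'_def assignment_def ran_map_upd)
    qed
    have att: "attendance A' c = attendance A c + of_bool (c = b)" for c
    proof -
      have "{j. A' j = Some c} = (if c = b then insert i {j. A j = Some c} else {j. A j = Some c})"
        using i by (auto simp: A'_def)
      then show ?thesis
        using i finite_attendees[OF A] by (simp add: attendance_def)
    qed
    have w: "within_capacity X S A'"
      using less.prems b A' att by (auto simp: within_capacity_def)
    have "finite (dom A)" using A finite_students finite_subset by (auto simp: assignment_def)
    then have "card (dom A') = Suc (card (dom A))" using i by (simp add: A'_def domIff)
    then have "cost X S - card (dom A') < cost X S - card (dom A)" using lt by simp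
    from less.hyps[OF this w] obtain A'' where A'': "realizes X S A''" "profit X A' \<le> profit X A''"
      by blast
    have "profit X A \<le> profit X A'"
      unfolding profit_eq_sum[OF A] profit_eq_sum[OF A']
      using student_profit_nonneg[OF i(1) b(1)] i
      by (intro sum_mono) (auto simp: A'_def option_profit_def split: if_splits)
    then show ?thesis using A'' by force
  qed
qed

lemma realizes_imp_within_capacity: "realizes X S A \<Longrightarrow> within_capacity X S A"
  by (simp add: realizes_def within_capacity_def)

lemma realization_exists: "feasible_selection X S \<Longrightarrow> \<exists>A. realizes X S A"
  using extend_to_realization[OF _ within_capacity_empty] by (auto simp: feasible_selection_def)

lemma optimal_exists:
  assumes "feasible_selection X S"
  obtains A where "optimal_for X S A"
proof -
  obtain A0 where "realizes X S A0" using realization_exists[OF assms] by blast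
  from ex_max_profit[where P = "realizes X S", OF _ this] show ?thesis
    using that by (auto simp: optimal_for_def selection_profit_def realizes_def)
qed

lemma selection_profit_eq_capacity_profit:
  assumes "feasible_selection X S"
  shows "selection_profit X S = capacity_profit X S"
proof (rule antisym)
  obtain A where "optimal_for X S A" using optimal_exists[OF assms] .
  then show "selection_profit X S \<le> capacity_profit X S"
    using profit_le_capacity_profit realizes_imp_within_capacity by (fastforce simp: optimal_for_def)
next
  obtain A where A: "within_capacity X S A" "profit X A = capacity_profit X S"
    by (rule capacity_profit_attained)
  obtain A' where "realizes X S A'" "profit X A \<le> profit X A'"
    using extend_to_realization A(1) assms unfolding feasible_selection_def by blast
  moreover have "profit X A' \<le> selection_profit X S"
    unfolding selection_profit_def using \<open>realizes X S A'\<close>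
    by (intro profit_le_Max[where P = "realizes X S"]) (auto simp: realizes_def)
  ultimately show "capacity_profit X S \<le> selection_profit X S" using A by simp
qed

section \<open>The optimum as the profit of a selection\<close>

lemma realizes_feasible:
  "feasible_selection X S \<Longrightarrow> realizes X S A \<Longrightarrow> feasible_assignment X A"
  by (simp add: feasible_selection_def selection_def realizes_def feasible_assignment_def)

lemma feasible_assignment_empty: "feasible_assignment X Map.empty"
  by (simp add: feasible_assignment_def assignment_empty attendance_def zero_allowable)

lemma profit_le_max_profit: "feasible_assignment X A \<Longrightarrow> profit X A \<le> max_profit X"
  unfolding max_profit_def
  by (intro profit_le_Max[where P = "feasible_assignment X"]) (auto simp: feasible_assignment_def)

lemma feasible_selection_attendance:
  assumes "feasible_assignment X A"
  shows "feasible_selection X (attendance A)"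
proof -
  have A: "assignment X A" using assms by (simp add: feasible_assignment_def)
  have "card (dom A) \<le> card (students X)"
    using A finite_students by (intro card_mono) (auto simp: assignment_def)
  then show ?thesis
    using assms attendance_outside[OF A] sum_attendance[OF A]
    by (simp add: feasible_selection_def selection_def feasible_assignment_def cost_def)
qed

lemma capacity_profit_le_max_profit:
  assumes "feasible_selection X S"
  shows "capacity_profit X S \<le> max_profit X"
proof -
  obtain A where "optimal_for X S A" using optimal_exists[OF assms] .
  then show ?thesis
    using profit_le_max_profit realizes_feasible[OF assms]
      selection_profit_eq_capacity_profit[OF assms] by (force simp: optimal_for_def)
qed

text \<open>The attendance of an optimal assignment is a feasible selection. It serves as the target
  \<open>T\<close> with which the greedy selections are compared.\<close>

lemma max_profit_attained:
  obtains T where "feasible_selection X T" "max_profit X = capacity_profit X T"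
proof -
  obtain A where A: "feasible_assignment X A" "profit X A = max_profit X"
    using ex_max_profit[of "feasible_assignment X", OF _ feasible_assignment_empty]
    unfolding max_profit_def by (auto simp: feasible_assignment_def)
  have "within_capacity X (attendance A) A"
    using A by (simp add: within_capacity_def feasible_assignment_def)
  then have "max_profit X \<le> capacity_profit X (attendance A)"
    using profit_le_capacity_profit A(2) by fastforce
  with capacity_profit_le_max_profit feasible_selection_attendance[OF A(1)] that
  show ?thesis by force
qed

section \<open>Submodularity\<close>

text \<open>Let \<open>A\<close> and \<open>B\<close> be optimal for \<open>S\<close> and
  \<open>T\<close>. The colouring splits the change from \<open>A\<close> to \<open>B\<close> into
  partial changes whose gains add up to the total gain. The one of colour \<open>Some b\<close>
  exceeds the quotas \<open>S\<close> at most at \<open>b\<close>, and there only up to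
  \<open>T b\<close>, so its gain is bounded by that of the raise at \<open>b\<close>.\<close>

lemma capacity_profit_submodular:
  "capacity_profit X T - capacity_profit X S
    \<le> (\<Sum>b\<in>{b\<in>seminars X. S b < T b}. capacity_profit X (S(b := T b)) - capacity_profit X S)"
proof -
  obtain A where A: "within_capacity X S A" "profit X A = capacity_profit X S"
    by (rule capacity_profit_attained)
  obtain B where B: "within_capacity X T B" "profit X B = capacity_profit X T"
    by (rule capacity_profit_attained)
  note aA = within_capacity_assignment[OF A(1)] and aB = within_capacity_assignment[OF B(1)]
  let ?I = "students X"
  obtain g where g: "\<And>i. i \<in> ?I \<Longrightarrow> g i \<in> B ` ?I"
    "\<And>c v. net_arcs A B {i\<in>?I. g i = c} v \<le> (if v = c then max 0 (net_arcs A B ?I v) else 0)"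
    using exchange_colouring[OF finite_students, of B A] by blast
  \<comment> \<open>All possible colours. \<open>None\<close> stands for the paths whose last
    student becomes unassigned.\<close>
  define C where "C = insert None (Some ` seminars X)"
  have gC: "g i \<in> C" if i: "i \<in> ?I" for i
  proof -
    obtain j where "g i = B j" using g(1)[OF i] by blast
    then show ?thesis using assignment_SomeD(2)[OF aB, of j] by (cases "B j") (auto simp: C_def)
  qed
  have finC: "finite C" using finite_seminars by (simp add: C_def)
  \<comment> \<open>M c starts from A and lets exactly the students of colour c move to their seminar in B.\<close>
  define M where "M c = (\<lambda>i. if i \<in> ?I \<and> g i = c then B i else A i)" for c
  have aM: "assignment X (M c)" for c
    unfolding assignment_def
  proof
    show "dom (M c) \<subseteq> students X" using aA by (auto simp: M_def assignment_def dom_def)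
    show "ran (M c) \<subseteq> seminars X"
      using assignment_SomeD(2)[OF aA] assignment_SomeD(2)[OF aB]
      by (auto simp: M_def ran_def split: if_splits)
  qed
  have netI: "net_arcs A B ?I (Some b) = int (attendance B b) - int (attendance A b)" for b
    by (simp add: net_arcs_def sum_subtractf attendance_int[OF aA] attendance_int[OF aB])
  have attM: "int (attendance (M c) b)
      = int (attendance A b) + net_arcs A B {i\<in>?I. g i = c} (Some b)" for c b
  proof -
    have "net_arcs A B {i\<in>?I. g i = c} (Some b)
        = (\<Sum>i\<in>?I. if g i = c then of_bool (B i = Some b) - of_bool (A i = Some b) else 0)"
      unfolding net_arcs_def using finite_students by (rule sum.inter_filter)
    also have "\<dots> = (\<Sum>i\<in>?I. of_bool (M c i = Some b) - of_bool (A i = Some b))"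
      by (intro sum.cong) (auto simp: M_def)
    finally show ?thesis
      by (simp add: sum_subtractf attendance_int[OF aA] attendance_int[OF aM])
  qed
  have att_other: "attendance (M c) b \<le> S b" if "b \<in> seminars X" "c \<noteq> Some b" for c b
    using attM[of c b] g(2)[of c "Some b"] that A(1) by (force simp: within_capacity_def)
  have att_own: "attendance (M (Some b)) b \<le> max (S b) (T b)" if b: "b \<in> seminars X" for b
  proof -
    have "attendance (M (Some b)) b \<le> max (attendance A b) (attendance B b)"
      using attM[of "Some b" b] g(2)[of "Some b" "Some b"] netI[of b] by simp
    moreover have "attendance A b \<le> S b" "attendance B b \<le> T b"
      using A(1) B(1) b by (auto simp: within_capacity_def)
    ultimately show ?thesis by simp
  qed
  define \<delta> where "\<delta> c = profit X (M c) - profit X A" for c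
  \<comment> \<open>These colours overfill no seminar, so \<open>M c\<close> still respects
    \<open>S\<close> and cannot beat the optimal \<open>A\<close>.\<close>
  have nonpos: "\<delta> c \<le> 0" if "\<And>b. b \<in> seminars X \<Longrightarrow> c = Some b \<Longrightarrow> T b \<le> S b" for c
  proof -
    have "attendance (M c) b \<le> S b" if "b \<in> seminars X" for b
      using att_other[of b c] att_own[of b] that \<open>b \<in> seminars X \<Longrightarrow> c = Some b \<Longrightarrow> T b \<le> S b\<close>
      by (cases "c = Some b") auto
    then have "within_capacity X S (M c)" using aM by (simp add: within_capacity_def)
    then show ?thesis using profit_le_capacity_profit A(2) by (fastforce simp: \<delta>_def)
  qed
  have bound: "\<delta> (Some b) \<le> capacity_profit X (S(b := T b)) - capacity_profit X S"
    if "b \<in> seminars X" "S b < T b" for b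
  proof -
    have "within_capacity X (S(b := T b)) (M (Some b))"
      using aM att_other[of _ "Some b"] att_own[of b] that by (auto simp: within_capacity_def)
    then show ?thesis using profit_le_capacity_profit A(2) by (fastforce simp: \<delta>_def)
  qed
  have "profit X B - profit X A
      = (\<Sum>i\<in>?I. option_profit X i (B i) - option_profit X i (A i))"
    by (simp add: profit_eq_sum aA aB sum_subtractf)
  \<comment> \<open>Student \<open>i\<close> can deviate from \<open>A\<close> only in
    \<open>M (g i)\<close>, so at most one term of the inner sum is nonzero.\<close>
  also have "\<dots> = (\<Sum>i\<in>?I. \<Sum>c\<in>C. option_profit X i (M c i) - option_profit X i (A i))"
  proof (intro sum.cong refl)
    fix i assume i: "i \<in> ?I"
    have "(\<Sum>c\<in>C. option_profit X i (M c i) - option_profit X i (A i))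
        = (\<Sum>c\<in>C. if c = g i then option_profit X i (B i) - option_profit X i (A i) else 0)"
      using i by (intro sum.cong) (auto simp: M_def)
    then show "option_profit X i (B i) - option_profit X i (A i)
        = (\<Sum>c\<in>C. option_profit X i (M c i) - option_profit X i (A i))"
      using gC[OF i] finC by simp
  qed
  also have "\<dots> = (\<Sum>c\<in>C. \<delta> c)"
    by (subst sum.swap) (simp add: \<delta>_def profit_eq_sum aA aM sum_subtractf)
  also have "\<dots> = \<delta> None + (\<Sum>b\<in>seminars X. \<delta> (Some b))"
    using finite_seminars by (simp add: C_def sum.reindex image_iff)
  also have "\<dots> \<le> (\<Sum>b\<in>seminars X. \<delta> (Some b))"
    using nonpos[of None] by simp
  also have "\<dots> \<le> (\<Sum>b\<in>seminars X.
      if S b < T b then capacity_profit X (S(b := T b)) - capacity_profit X S else 0)"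
    using bound by (intro sum_mono) (auto intro: nonpos)
  also have "\<dots> = (\<Sum>b\<in>{b\<in>seminars X. S b < T b}.
      capacity_profit X (S(b := T b)) - capacity_profit X S)"
    using finite_seminars by (simp add: sum.inter_filter)
  finally show ?thesis using A B by simp
qed

section \<open>Contribution of a single seminar\<close>

text \<open>Split an optimal assignment for the raised quotas into the students of \<open>b\<close>
  and all others. The others respect \<open>S\<close>, since they leave \<open>b\<close>
  empty.\<close>

lemma capacity_profit_single_update:
  "capacity_profit X (S(b := t)) \<le> capacity_profit X S + capacity_profit X ((\<lambda>_. 0)(b := t))"
proof -
  obtain A where A: "within_capacity X (S(b := t)) A" "profit X A = capacity_profit X (S(b := t))"
    by (rule capacity_profit_attained)
  note aA = within_capacity_assignment[OF A(1)]
  define A1 where "A1 i = (if A i = Some b then None else A i)" for i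
  define A2 where "A2 i = (if A i = Some b then A i else None)" for i
  have a: "assignment X A1" "assignment X A2"
    using aA by (auto simp: A1_def A2_def assignment_def dom_def ran_def split: if_splits)
  have att: "attendance A1 c = (if c = b then 0 else attendance A c)"
    "attendance A2 c = (if c = b then attendance A c else 0)" for c
    by (auto simp: attendance_def A1_def A2_def intro!: arg_cong[of _ _ card])
  have "within_capacity X S A1" "within_capacity X ((\<lambda>_. 0)(b := t)) A2"
    using A(1) a by (auto simp: within_capacity_def att split: if_splits)
  then have "profit X A1 \<le> capacity_profit X S" "profit X A2 \<le> capacity_profit X ((\<lambda>_. 0)(b := t))"
    by (auto intro: profit_le_capacity_profit)
  moreover have "profit X A = profit X A1 + profit X A2"
    unfolding profit_eq_sum[OF aA] profit_eq_sum[OF a(1)] profit_eq_sum[OF a(2)] sum.distrib[symmetric]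
    by (intro sum.cong) (auto simp: A1_def A2_def option_profit_def)
  ultimately show ?thesis using A by simp
qed

lemma cost_update:
  "b \<in> seminars X \<Longrightarrow> cost X (S(b := t)) + S b = cost X S + t"
  unfolding cost_def using finite_seminars
  by (simp add: sum.remove[of "seminars X" b])

text \<open>Since 0 is allowable everywhere, keeping only the quota of \<open>b\<close> gives a
  feasible selection. An optimal assignment for it uses no seminar but \<open>b\<close>, and
  \<open>b\<close> is eligible because the initial selection is empty.\<close>

lemma single_le_best:
  assumes "feasible_selection X T" "b \<in> seminars X"
    and best: "best_single_seminar_assignment X empty_selection A2"
  shows "capacity_profit X ((\<lambda>_. 0)(b := T b)) \<le> profit X A2"
proof -
  let ?U = "(\<lambda>_. 0)(b := T b)"
  have "cost X ?U = T b"
    using cost_update[OF assms(2), of "\<lambda>_. 0"] by (simp add: cost_def)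
  moreover have "T b \<le> cost X T"
    unfolding cost_def using assms(2) finite_seminars by (intro member_le_sum) auto
  ultimately have U: "feasible_selection X ?U"
    using assms zero_allowable by (auto simp: feasible_selection_def selection_def)
  obtain A where A: "optimal_for X ?U A" using optimal_exists[OF U] .
  then have r: "realizes X ?U A" and aA: "assignment X A"
    by (auto simp: optimal_for_def realizes_def)
  have "ran A \<subseteq> {b}"
  proof
    fix c assume "c \<in> ran A"
    then obtain i where i: "A i = Some c" by (auto simp: ran_def)
    then have "attendance A c \<noteq> 0" using attendance_eq_0_iff[OF aA] by blast
    moreover have "c \<in> seminars X" using assignment_SomeD[OF aA i] by blast
    ultimately show "c \<in> {b}" using r by (auto simp: realizes_def split: if_splits)
  qed
  then have "card (ran A) \<le> 1" using card_mono[of "{b}" "ran A"] by simp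
  then have "single_seminar_assignment X empty_selection A"
    using realizes_feasible[OF U r] \<open>ran A \<subseteq> {b}\<close> assms(2)
    by (auto simp: single_seminar_assignment_def empty_selection_def)
  then have "profit X A \<le> profit X A2"
    using best by (simp add: best_single_seminar_assignment_def)
  then show ?thesis using A selection_profit_eq_capacity_profit[OF U] by (simp add: optimal_for_def)
qed

section \<open>Greedy steps, termination and existence of an output\<close>

lemma feasible_empty_selection: "feasible_selection X empty_selection"
  by (simp add: feasible_selection_def selection_def empty_selection_def cost_def zero_allowable)

lemma incD:
  assumes "T \<in> inc X S"
  shows "feasible_selection X T" "cost X S < cost X T" "\<And>b. b \<in> seminars X \<Longrightarrow> S b \<le> T b"
proof -
  show "feasible_selection X T" "\<And>b. b \<in> seminars X \<Longrightarrow> S b \<le> T b"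
    using assms by (auto simp: inc_def dominates_def)
  show "cost X S < cost X T"
    using assms finite_seminars unfolding cost_def
    by (intro sum_strict_mono_ex1) (auto simp: inc_def dominates_def)
qed

lemma update_in_inc:
  assumes "feasible_selection X S" "feasible_selection X T" "b \<in> seminars X" "S b < T b"
    "cost X (S(b := T b)) \<le> card (students X)"
  shows "S(b := T b) \<in> inc X S"
  using assms by (auto simp: inc_def dominates_def feasible_selection_def selection_def split: if_splits)

text \<open>Every candidate is feasible, hence realized by some assignment and equal to its
  attendance; there are only finitely many assignments. This guarantees that a best ratio
  exists.\<close>

lemma finite_inc: "finite (inc X S)"
proof -
  have "inc X S \<subseteq> attendance ` {A. assignment X A}"
  proof
    fix T assume "T \<in> inc X S"
    then have T: "feasible_selection X T" by (rule incD)
    then obtain A where A: "realizes X T A" using realization_exists by blast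
    then have "T = attendance A"
      using T attendance_outside[of A]
      by (auto simp: realizes_def feasible_selection_def selection_def fun_eq_iff) metis
    then show "T \<in> attendance ` {A. assignment X A}" using A by (auto simp: realizes_def)
  qed
  then show ?thesis using finite_assignments finite_surj by blast
qed

lemma greedy_step_exists:
  assumes "inc X S \<noteq> {}"
  shows "\<exists>T. greedy_step X S T"
proof -
  let ?r = "incremental_ratio X S"
  have "Max (?r ` inc X S) \<in> ?r ` inc X S" using finite_inc assms by (intro Max_in) auto
  then obtain T where "T \<in> inc X S" "?r T = Max (?r ` inc X S)" by auto
  then have "greedy_step X S T" using finite_inc by (auto simp: greedy_step_def)
  then show ?thesis by blast
qed

lemma reachable_feasible:
  assumes "(greedy_step X)\<^sup>*\<^sup>* empty_selection S"
  shows "feasible_selection X S"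
  using assms
  by (induction rule: rtranclp_induct) (auto simp: feasible_empty_selection greedy_step_def dest: incD)

text \<open>Each step raises the cost by at least 1, while the cost of a feasible selection is at
  most the number of students.\<close>

lemma greedy_terminates_empty: "greedy_terminates X empty_selection"
proof -
  have False if f: "f 0 = empty_selection" "\<And>n. greedy_step X (f n) (f (Suc n))"
    for f :: "nat \<Rightarrow> 'b \<Rightarrow> nat"
  proof -
    have step: "f (Suc n) \<in> inc X (f n)" for n using f(2) by (simp add: greedy_step_def)
    have "n \<le> cost X (f n)" for n
      using incD(2)[OF step] by (induction n) (auto simp: Suc_le_eq intro: le_less_trans)
    from this[of "Suc (card (students X))"] show False
      using incD(1)[OF step, of "card (students X)"] by (simp add: feasible_selection_def)
  qed
  then show ?thesis using greedy_step_exists unfolding greedy_terminates_def by blast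
qed

text \<open>A reachable selection of largest cost admits no further step.\<close>

lemma greedy_final_exists: "\<exists>S. greedy_final X empty_selection S"
proof -
  let ?R = "(greedy_step X)\<^sup>*\<^sup>* empty_selection"
  have "\<exists>S. ?R S \<and> (\<forall>S'. ?R S' \<longrightarrow> cost X S' \<le> cost X S)"
    using ex_has_greatest_nat[of ?R empty_selection "cost X" "Suc (card (students X))"] reachable_feasible
    by (auto simp: feasible_selection_def le_imp_less_Suc)
  then obtain S where S: "?R S" "\<And>S'. ?R S' \<Longrightarrow> cost X S' \<le> cost X S" by blast
  have "inc X S = {}"
  proof (rule ccontr)
    assume "inc X S \<noteq> {}"
    then obtain T where T: "greedy_step X S T" using greedy_step_exists by blast
    then have "cost X T \<le> cost X S" using S by (meson rtranclp.rtrancl_into_rtrancl)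
    then show False using T incD(2)[of T S] by (simp add: greedy_step_def)
  qed
  then show ?thesis using S by (auto simp: greedy_final_def)
qed

lemma greedy_output_exists: "\<exists>A. greedy_output X empty_selection A"
proof -
  obtain S where S: "greedy_final X empty_selection S" using greedy_final_exists by blast
  then have "feasible_selection X S" by (auto simp: greedy_final_def reachable_feasible)
  then obtain A1 where A1: "optimal_for X S A1" by (rule optimal_exists)
  let ?P = "single_seminar_assignment X empty_selection"
  have P: "?P A \<Longrightarrow> assignment X A" for A
    by (simp add: single_seminar_assignment_def feasible_assignment_def)
  have "?P Map.empty"
    by (simp add: single_seminar_assignment_def feasible_assignment_empty)
  from ex_max_profit[of ?P, OF P this] profit_le_Max[of ?P, OF P]
  obtain A2 where "best_single_seminar_assignment X empty_selection A2"
    by (fastforce simp: best_single_seminar_assignment_def)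
  with S A1 have "greedy_output X empty_selection (if profit X A1 \<ge> profit X A2 then A1 else A2)"
    unfolding greedy_output_def by (metis linear)
  then show ?thesis by blast
qed

section \<open>The approximation guarantee\<close>

text \<open>The seminar b found here may violate the bound on the number of students, so the raise need
  not belong to the candidates of the greedy step.\<close>

lemma good_ratio_exists:
  assumes S: "feasible_selection X S" and T: "feasible_selection X T"
    and lt: "capacity_profit X S < capacity_profit X T"
  obtains b where "b \<in> seminars X" "S b < T b"
    "(real (T b) - real (S b)) * (capacity_profit X T - capacity_profit X S)
      \<le> real (card (students X)) * (capacity_profit X (S(b := T b)) - capacity_profit X S)"
proof -
  let ?O = "{b\<in>seminars X. S b < T b}" and ?n = "real (card (students X))"
  let ?gap = "capacity_profit X T - capacity_profit X S"
  let ?gain = "\<lambda>b. capacity_profit X (S(b := T b)) - capacity_profit X S"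
  have sub: "?gap \<le> (\<Sum>b\<in>?O. ?gain b)" by (rule capacity_profit_submodular)
  have "?O \<noteq> {}"
  proof
    assume "?O = {}"
    then have "(\<Sum>b\<in>?O. ?gain b) = 0" by (simp only: sum.empty)
    then show False using sub lt by linarith
  qed
  \<comment> \<open>Averaging: the raises cost at most \<open>cost X T\<close>, hence at most
    \<open>?n\<close>, in total. If each gained less than its share of \<open>?gap\<close>, their
    gains could not add up to \<open>?gap\<close>, against submodularity.\<close>
  have "\<exists>b\<in>?O. (real (T b) - real (S b)) * ?gap \<le> ?n * ?gain b"
  proof (rule ccontr)
    assume "\<not> ?thesis"
    then have "(\<Sum>b\<in>?O. ?n * ?gain b) < (\<Sum>b\<in>?O. (real (T b) - real (S b)) * ?gap)"
      using \<open>?O \<noteq> {}\<close> finite_seminars by (intro sum_strict_mono) (auto simp: not_le)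
    also have "\<dots> = (\<Sum>b\<in>?O. real (T b) - real (S b)) * ?gap" by (simp only: sum_distrib_right)
    also have "\<dots> \<le> ?n * ?gap"
    proof (rule mult_right_mono)
      have "(\<Sum>b\<in>?O. real (T b) - real (S b)) \<le> (\<Sum>b\<in>?O. real (T b))"
        by (intro sum_mono) auto
      also have "\<dots> \<le> (\<Sum>b\<in>seminars X. real (T b))"
        using finite_seminars by (intro sum_mono2) auto
      also have "\<dots> = real (cost X T)" by (simp add: cost_def)
      also have "\<dots> \<le> ?n" using T by (simp add: feasible_selection_def)
      finally show "(\<Sum>b\<in>?O. real (T b) - real (S b)) \<le> ?n" .
    qed (use lt in simp)
    also have "\<dots> \<le> ?n * (\<Sum>b\<in>?O. ?gain b)" using sub by (intro mult_left_mono) auto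
    finally show False by (simp add: sum_distrib_left)
  qed
  then show ?thesis using that by blast
qed

text \<open>The extended profit is defined even for the infeasible raise, so
  \<open>gap_contraction\<close> applies to it. The raised cost exceeds the number of students,
  which brings the exponent to at most -1. The bound is used both during the run and at its
  end.\<close>

lemma infeasible_choice_bound:
  assumes S: "feasible_selection X S" and T: "feasible_selection X T"
    and opt: "max_profit X = capacity_profit X T"
    and best: "best_single_seminar_assignment X empty_selection A2"
    and b: "b \<in> seminars X" "S b < T b" and over: "card (students X) < cost X (S(b := T b))"
    and ratio: "(real (T b) - real (S b)) * (max_profit X - capacity_profit X S)
      \<le> real (card (students X)) * (capacity_profit X (S(b := T b)) - capacity_profit X S)"
    and gap: "max_profit X - capacity_profit X S
      \<le> exp (- real (cost X S) / real (card (students X))) * max_profit X"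
  shows "(1 - exp (-1)) * max_profit X \<le> capacity_profit X S + profit X A2"
proof -
  let ?n = "real (card (students X))"
  have "T b \<le> cost X T"
    unfolding cost_def using b finite_seminars by (intro member_le_sum) auto
  then have n: "0 < ?n" using T b by (auto simp: feasible_selection_def)
  have "max_profit X - capacity_profit X (S(b := T b))
      \<le> exp (- (real (cost X S) + (real (T b) - real (S b))) / ?n) * max_profit X"
    using n ratio capacity_profit_le_max_profit[OF S] gap by (rule gap_contraction)
  also have "\<dots> \<le> exp (-1) * max_profit X"
  proof (rule mult_right_mono)
    have "?n \<le> real (cost X S) + (real (T b) - real (S b))"
      using over cost_update[OF b(1), of S "T b"] by linarith
    then show "exp (- (real (cost X S) + (real (T b) - real (S b))) / ?n) \<le> exp (-1)"
      using n by (simp add: field_simps)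
  qed (simp add: opt capacity_profit_nonneg)
  finally have "(1 - exp (-1)) * max_profit X \<le> capacity_profit X (S(b := T b))"
    by (simp add: algebra_simps)
  also have "\<dots> \<le> capacity_profit X S + profit X A2"
    using capacity_profit_single_update[of S b "T b"] single_le_best[OF T b(1) best] by linarith
  finally show ?thesis .
qed

text \<open>The first alternative holds as long as the good raises found on the way are feasible.
  The second takes over at the first infeasible one and then persists, because the profit never
  decreases along a run.\<close>

lemma greedy_invariant:
  assumes reach: "(greedy_step X)\<^sup>*\<^sup>* empty_selection S"
    and best: "best_single_seminar_assignment X empty_selection A2"
  shows "max_profit X - capacity_profit X S
      \<le> exp (- real (cost X S) / real (card (students X))) * max_profit X \<or>
    (1 - exp (-1)) * max_profit X \<le> capacity_profit X S + profit X A2"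
  using reach
proof (induction rule: rtranclp_induct)
  case base
  \<comment> \<open>At cost 0 the exponent is 0, even without students, as division by zero yields
    0.\<close>
  show ?case using capacity_profit_nonneg by (simp add: cost_def empty_selection_def)
next
  case (step S S')
  obtain T where T: "feasible_selection X T" "max_profit X = capacity_profit X T"
    by (rule max_profit_attained)
  let ?n = "real (card (students X))"
  have S: "feasible_selection X S" using step reachable_feasible by blast
  have inc: "S' \<in> inc X S"
    and greedy: "\<And>U. U \<in> inc X S \<Longrightarrow> incremental_ratio X S U \<le> incremental_ratio X S S'"
    using step by (auto simp: greedy_step_def)
  have mono: "capacity_profit X S \<le> capacity_profit X S'"
    using incD(3)[OF inc] by (rule capacity_profit_mono)
  have ratio_eq: "incremental_ratio X S U
      = (capacity_profit X U - capacity_profit X S) / (real (cost X U) - real (cost X S))"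
    if "U \<in> inc X S" for U
    using S incD(1)[OF that] by (simp add: incremental_ratio_def selection_profit_eq_capacity_profit)
  from step.IH show ?case
  proof
    assume "(1 - exp (-1)) * max_profit X \<le> capacity_profit X S + profit X A2"
    then show ?thesis using mono by linarith
  next
    assume gap: "max_profit X - capacity_profit X S \<le> exp (- real (cost X S) / ?n) * max_profit X"
    show ?thesis
    proof (cases "capacity_profit X S < capacity_profit X T")
      \<comment> \<open>Here \<open>S\<close> is already optimal, so no positive gap is left after
        the step.\<close>
      case False
      then have "max_profit X - capacity_profit X S' \<le> 0" using mono T by simp
      also have "0 \<le> exp (- real (cost X S') / ?n) * max_profit X"
        by (simp add: T capacity_profit_nonneg)
      finally show ?thesis by blast
    next
      case True
      obtain b where b: "b \<in> seminars X" "S b < T b"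
        and ratio: "(real (T b) - real (S b)) * (max_profit X - capacity_profit X S)
          \<le> ?n * (capacity_profit X (S(b := T b)) - capacity_profit X S)"
        using good_ratio_exists[OF S T(1) True] unfolding T(2) by metis
      let ?U = "S(b := T b)"
      show ?thesis
      proof (cases "cost X ?U \<le> card (students X)")
        case False
        then have "card (students X) < cost X ?U" by simp
        from infeasible_choice_bound[OF S T best b this ratio gap] mono
        show ?thesis by linarith
      next
        case True
        have U: "?U \<in> inc X S" using update_in_inc[OF S T(1) b True] .
        have costU: "real (cost X ?U) - real (cost X S) = real (T b) - real (S b)"
          using cost_update[OF b(1), of S "T b"] by linarith
        have d: "0 < real (cost X S') - real (cost X S)" "0 < real (T b) - real (S b)"
          using incD(2)[OF inc] b by auto
        have n: "0 < ?n"
          using incD(1,2)[OF inc] by (auto simp: feasible_selection_def)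
        have "(max_profit X - capacity_profit X S) / ?n
            \<le> (capacity_profit X ?U - capacity_profit X S) / (real (T b) - real (S b))"
          using ratio n d by (simp add: divide_simps mult.commute)
        \<comment> \<open>The feasible raise \<open>?U\<close> competes with \<open>S'\<close> in
          this step, so the greedy choice has at least its ratio.\<close>
        also have "\<dots> \<le> (capacity_profit X S' - capacity_profit X S)
            / (real (cost X S') - real (cost X S))"
          using greedy[OF U] ratio_eq[OF U] ratio_eq[OF inc] costU by simp
        finally have "(real (cost X S') - real (cost X S)) * (max_profit X - capacity_profit X S)
            \<le> ?n * (capacity_profit X S' - capacity_profit X S)"
          using n d by (simp add: divide_simps mult.commute)
        from gap_contraction[OF n this capacity_profit_le_max_profit[OF S] gap]
        show ?thesis by simp
      qed
    qed
  qed
qed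

text \<open>When no candidate is left, the good raise towards \<open>T\<close> must be infeasible,
  unless \<open>S\<close> is already optimal.\<close>

lemma greedy_final_bound:
  assumes final: "greedy_final X empty_selection S"
    and best: "best_single_seminar_assignment X empty_selection A2"
  shows "(1 - exp (-1)) * max_profit X \<le> capacity_profit X S + profit X A2"
proof -
  obtain T where T: "feasible_selection X T" "max_profit X = capacity_profit X T"
    by (rule max_profit_attained)
  have reach: "(greedy_step X)\<^sup>*\<^sup>* empty_selection S" and empty: "inc X S = {}"
    using final by (auto simp: greedy_final_def)
  have S: "feasible_selection X S" using reach by (rule reachable_feasible)
  from greedy_invariant[OF reach best] show ?thesis
  proof
    assume gap: "max_profit X - capacity_profit X S
      \<le> exp (- real (cost X S) / real (card (students X))) * max_profit X"
    show ?thesis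
    proof (cases "capacity_profit X S < capacity_profit X T")
      case True
      obtain b where b: "b \<in> seminars X" "S b < T b"
        and ratio: "(real (T b) - real (S b)) * (max_profit X - capacity_profit X S)
          \<le> real (card (students X)) * (capacity_profit X (S(b := T b)) - capacity_profit X S)"
        using good_ratio_exists[OF S T(1) True] unfolding T(2) by metis
      have "card (students X) < cost X (S(b := T b))"
        using update_in_inc[OF S T(1) b] empty by (metis empty_iff not_le)
      from infeasible_choice_bound[OF S T best b this ratio gap] show ?thesis .
    next
      case False
      have "(1 - exp (-1)) * max_profit X \<le> 1 * max_profit X"
        by (intro mult_right_mono) (auto simp: T capacity_profit_nonneg)
      moreover have "0 \<le> profit X A2"
        using best by (auto simp: best_single_seminar_assignment_def single_seminar_assignment_def
            feasible_assignment_def intro: profit_nonneg)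
      ultimately show ?thesis using False T by simp
    qed
  qed
qed

text \<open>The larger of two profits is at least half their sum, which gives the factor
  1/2.\<close>

lemma greedy_output_bound:
  assumes "greedy_output X empty_selection A"
  shows "feasible_assignment X A \<and> 1 / 2 * (1 - exp (-1)) * max_profit X \<le> profit X A"
proof -
  obtain S A1 A2 where out: "greedy_final X empty_selection S" "optimal_for X S A1"
    "best_single_seminar_assignment X empty_selection A2"
    "A = A1 \<and> profit X A1 \<ge> profit X A2 \<or> A = A2 \<and> profit X A2 \<ge> profit X A1"
    using assms by (auto simp: greedy_output_def)
  have S: "feasible_selection X S" using out(1) by (auto simp: greedy_final_def reachable_feasible)
  have "feasible_assignment X A1" "feasible_assignment X A2"
    using out realizes_feasible[OF S]
    by (auto simp: optimal_for_def best_single_seminar_assignment_def single_seminar_assignment_def)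
  moreover have "profit X A1 = capacity_profit X S"
    using out(2) selection_profit_eq_capacity_profit[OF S] by (simp add: optimal_for_def)
  ultimately show ?thesis using greedy_final_bound[OF out(1,3)] out(4) by auto
qed

end

theorem theorem4:
  fixes X :: "('i, 'b) sap"
  assumes "sap_instance X"
  shows "greedy_terminates X empty_selection \<and>
    (\<exists>A. greedy_output X empty_selection A) \<and>
    (\<forall>A. greedy_output X empty_selection A \<longrightarrow>
       feasible_assignment X A \<and>
       profit X A \<ge> 1 / 2 * (1 - exp (-1)) * max_profit X)"
  using greedy_terminates_empty[OF assms] greedy_output_exists[OF assms]
    greedy_output_bound[OF assms] by blast

end
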